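(* Consider the generalized Ornstein–Uhlenbeck (GOU) process on $[0,T]$ initialized at $\mathbf{x}_0\in\mathbb{R}^d$, whose terminal transition density is $$p(\mathbf{x},T\mid\mathbf{x}_0,0)=\mathcal{N}(\mathbf{x};\bar{\boldsymbol{\mu}}_{0:T},\bar{\sigma}_{0:T}^2\mathbf{I}),$$ where $\bar{\boldsymbol{\mu}}_{0:T}$ and $\bar{\sigma}_{0:T}^2$ denote the conditional mean and variance of the state at time $T$ given $\mathbf{x}_0$. Let $q$ be a nonnegative probability density on $\mathbb{R}^d$ and define $$h(\mathbf{x},t)=\int_{\mathbb{R}^d} p(\mathbf{z},T\mid\mathbf{x},t)\,q(\mathbf{z})\,\mathrm{d}\mathbf{z}.$$ Assume that the terminal marginal under the $h$-transformed measure is $$p_h(\mathbf{x},T\mid\mathbf{x}_0,0)=\mathcal{N}(\mathbf{x};\mathbf{x}^{\ast},\sigma^2\mathbf{I})$$ for some $\mathbf{x}^{\ast}\in\mathbb{R}^d$ and some $0<\sigma^2<\bar{\sigma}_{0:T}^2$. Then $q$ is uniquely determined up to almost-everywhere equality and is given by $q(\mathbf{x})=\mathcal{N}(\mathbf{x};\hat{\mathbf{x}},\hat{\sigma}^2\mathbf{I})$, where $$\hat{\mathbf{x}}=\frac{\bar{\sigma}_{0:T}^2}{\bar{\sigma}_{0:T}^2-\sigma^2}\,\mathbf{x}^{\ast}-\frac{\sigma^2}{\bar{\sigma}_{0:T}^2-\sigma^2}\,\bar{\boldsymbol{\mu}}_{0:T},\qquad \hat{\sigma}^2=\frac{\sig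ma^2\bar{\sigma}_{0:T}^2}{\bar{\sigma}_{0:T}^2-\sigma^2}.$$
   Context: $\mathcal{N}(\mathbf{x};\mathbf{m},s^2\mathbf{I})$ denotes the density at $\mathbf{x}\in\mathbb{R}^d$ of the Gaussian with mean $\mathbf{m}$ and covariance $s^2\mathbf{I}$. GOU process: $\mathrm{d}\mathbf{x}_t=\theta_t(\boldsymbol{\mu}-\mathbf{x}_t)\,\mathrm{d}t+g_t\,\mathrm{d}\mathbf{w}_t$, with $\boldsymbol{\mu}\in\mathbb{R}^d$ fixed, $\theta_t>0$ and $g_t$ deterministic scalar coefficients, $\mathbf{w}$ a standard $d$-dimensional Wiener process. Its transition density for $0\le s<t\le T$ is $p(\mathbf{x}_t,t\mid\mathbf{x}_s,s)=\mathcal{N}(\mathbf{x}_t;\bar{\boldsymbol{\mu}}_{s:t},\bar{\sigma}_{s:t}^2\mathbf{I})$ with $$\bar{\theta}_{s:t}=\int_s^t\theta_u\,\mathrm{d}u,\quad \bar{\boldsymbol{\mu}}_{s:t}=e^{-\bar{\theta}_{s:t}}\mathbf{x}_s+(1-e^{-\bar{\theta}_{s:t}})\boldsymbol{\mu},\quad \bar{\sigma}_{s:t}^2=\int_s^t e^{-2\bar{\theta}_{u:t}}g_u^2\,\mathrm{d}u .$$ Doob $h$-transform with terminal weight $q$: $h(\mathbf{x},T)=q(\mathbf{x})$, and the terminal marginal of the $h$-transformed process started at $\mathbf{x}_0$ is $$p_h(\mathbf{x},T\mid\mathbf{x}_0,0)=\frac{p(\mathbf{x},T\mid\mathbf{x}_0,0)\,q(\mathbf{x})}{h(\mathbf{x}_0,0)}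 .$$ *)

theory Defs
  imports "HOL-Analysis.Analysis"
begin

text \<open>
  Density at \<open>x\<close> of the Gaussian with mean \<open>m\<close> and covariance \<open>v I\<close>; the last argument is the
  variance, not the standard deviation.
\<close>
definition iso_gauss :: "real ^ 'n \<Rightarrow> real ^ 'n \<Rightarrow> real \<Rightarrow> real" where
  "iso_gauss x m v =
     (2 * pi * v) powr (- real CARD('n) / 2) * exp (- (norm (x - m))\<^sup>2 / (2 * v))"

definition prob_density :: "(real ^ 'n \<Rightarrow> real) \<Rightarrow> bool" where
  "prob_density q \<longleftrightarrow> (\<forall>x. 0 \<le> q x) \<and> has_bochner_integral lborel q 1"

definition gou_theta_bar :: "(real \<Rightarrow> real) \<Rightarrow> real \<Rightarrow> real \<Rightarrow> real" where
  "gou_theta_bar \<theta> s t = integral {s..t} \<theta>"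

definition gou_mean :: "(real \<Rightarrow> real) \<Rightarrow> real ^ 'n \<Rightarrow> real \<Rightarrow> real \<Rightarrow> real ^ 'n \<Rightarrow> real ^ 'n" where
  "gou_mean \<theta> \<mu> s t x =
     exp (- gou_theta_bar \<theta> s t) *\<^sub>R x + (1 - exp (- gou_theta_bar \<theta> s t)) *\<^sub>R \<mu>"

definition gou_var :: "(real \<Rightarrow> real) \<Rightarrow> (real \<Rightarrow> real) \<Rightarrow> real \<Rightarrow> real \<Rightarrow> real" where
  "gou_var \<theta> g s t = integral {s..t} (\<lambda>u. exp (- 2 * gou_theta_bar \<theta> u t) * (g u)\<^sup>2)"

text \<open>
  Transition density \<open>p(y, t | x, s)\<close>, for \<open>s < t\<close>, of the process
  \<open>dx\<^sub>t = \<theta>\<^sub>t (\<mu> - x\<^sub>t) dt + g\<^sub>t dw\<^sub>t\<close>.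
\<close>
definition gou_density ::
  "(real \<Rightarrow> real) \<Rightarrow> (real \<Rightarrow> real) \<Rightarrow> real ^ 'n \<Rightarrow>
   real ^ 'n \<Rightarrow> real \<Rightarrow> real ^ 'n \<Rightarrow> real \<Rightarrow> real" where
  "gou_density \<theta> g \<mu> y t x s = iso_gauss y (gou_mean \<theta> \<mu> s t x) (gou_var \<theta> g s t)"

text \<open>
  At \<open>t = T\<close> the transition law is a point mass without a density, hence the separate
  terminal value \<open>h(x, T) = q(x)\<close>.
\<close>
definition gou_h ::
  "(real \<Rightarrow> real) \<Rightarrow> (real \<Rightarrow> real) \<Rightarrow> real ^ 'n \<Rightarrow> real \<Rightarrow> (real ^ 'n \<Rightarrow> real) \<Rightarrow>
   real ^ 'n \<Rightarrow> real \<Rightarrow> real" where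
  "gou_h \<theta> g \<mu> T q x t =
     (if t < T then (\<integral>z. gou_density \<theta> g \<mu> z T x t * q z \<partial>lborel) else q x)"

text \<open>
  Terminal marginal \<open>p\<^sub>h(x, T | x\<^sub>0, 0)\<close> of the \<open>h\<close>-transformed process started at \<open>x\<^sub>0\<close>.
\<close>
definition gou_h_terminal_density ::
  "(real \<Rightarrow> real) \<Rightarrow> (real \<Rightarrow> real) \<Rightarrow> real ^ 'n \<Rightarrow> real \<Rightarrow> (real ^ 'n \<Rightarrow> real) \<Rightarrow>
   real ^ 'n \<Rightarrow> real ^ 'n \<Rightarrow> real" where
  "gou_h_terminal_density \<theta> g \<mu> T q x0 x =
     gou_density \<theta> g \<mu> x T x0 0 * q x / gou_h \<theta> g \<mu> T q x0 0"

end

theory Submission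
  imports Defs "HOL-Probability.Distributions"
begin

text \<open>
  The ratio of the target Gaussian \<open>N(x\<^sup>*, \<sigma>\<^sup>2 I)\<close> to the transition density is, after completing the
  square, a positive multiple of \<open>N(x_hat, \<sigma>_hat\<^sup>2 I)\<close>. The value \<open>h(x\<^sub>0, 0)\<close> is a nonzero constant,
  so \<open>q\<close> is almost everywhere a multiple of that Gaussian; both integrate to 1, so the factor is 1.
\<close>

lemma iso_gauss_pos:
  assumes "0 < v"
  shows "0 < iso_gauss x m v"
  using assms by (simp add: iso_gauss_def)

text \<open>Reduces the normalisation of the isotropic Gaussian to the one-dimensional case.
  \<open>normal_density\<close> takes a standard deviation, hence \<open>sqrt v\<close>.\<close>

lemma iso_gauss_eq_prod_normal_density:
  fixes x m :: "real ^ 'n"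
  assumes "0 < v"
  shows "iso_gauss x m v = (\<Prod>b\<in>Basis. normal_density (m \<bullet> b) (sqrt v) (x \<bullet> b))"
proof -
  have "(norm (x - m))\<^sup>2 = (\<Sum>b\<in>Basis. (x \<bullet> b - m \<bullet> b)\<^sup>2)"
    unfolding power2_norm_eq_inner euclidean_inner[of "x - m" "x - m"]
    by (simp add: inner_diff_left power2_eq_square)
  then have e: "exp (- (norm (x - m))\<^sup>2 / (2 * v)) =
      (\<Prod>b\<in>Basis. exp (- (x \<bullet> b - m \<bullet> b)\<^sup>2 / (2 * v)))"
    by (simp add: exp_sum[symmetric] sum_divide_distrib[symmetric] sum_negf)
  have "(2 * pi * v) powr (- real CARD('n) / 2) = ((2 * pi * v) powr (- 1 / 2)) powr real CARD('n)"
    by (simp add: powr_powr)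
  also have "\<dots> = (1 / sqrt (2 * pi * v)) ^ CARD('n)"
    using assms by (simp add: powr_realpow powr_minus_divide powr_half_sqrt)
  finally have "(2 * pi * v) powr (- real CARD('n) / 2) = (1 / sqrt (2 * pi * v)) ^ CARD('n)" .
  with e assms show ?thesis
    by (simp add: iso_gauss_def normal_density_def prod.distrib prod_dividef power_divide)
qed

lemma has_bochner_integral_iso_gauss:
  fixes m :: "real ^ 'n"
  assumes "0 < v"
  shows "has_bochner_integral lborel (\<lambda>x. iso_gauss x m v) 1"
proof (rule has_bochner_integral_nn_integral)
  show "(\<lambda>x. iso_gauss x m v) \<in> borel_measurable lborel"
    unfolding iso_gauss_def by measurable
  show "AE x in lborel. 0 \<le> iso_gauss x m v"
    using assms by (intro AE_I2 less_imp_le iso_gauss_pos)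
  have one: "(\<integral>\<^sup>+ t. ennreal (normal_density c (sqrt v) t) \<partial>lborel) = 1" for c
    using assms by (subst nn_integral_eq_integral)
      auto
  have "(\<integral>\<^sup>+ x. ennreal (iso_gauss x m v) \<partial>lborel) =
      (\<integral>\<^sup>+ x. (\<Prod>b\<in>Basis. ennreal (normal_density (m \<bullet> b) (sqrt v) (x \<bullet> b))) \<partial>lborel)"
    using assms by (simp add: iso_gauss_eq_prod_normal_density prod_ennreal)
  \<comment> \<open>Tonelli: each factor depends on a single coordinate.\<close>
  also have "\<dots> = (\<Prod>b\<in>(Basis :: (real ^ 'n) set).
      \<integral>\<^sup>+ t. ennreal (normal_density (m \<bullet> b) (sqrt v) t) \<partial>lborel)"
    by (rule nn_integral_lborel_prod) auto
  finally show "(\<integral>\<^sup>+ x. ennreal (iso_gauss x m v) \<partial>lborel) = ennreal 1"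
    by (simp add: one)
qed simp

text \<open>The left side is a quadratic in \<open>x\<close> with leading coefficient
  \<open>1 / s - 1 / V\<close>, the reciprocal of the new variance. The new centre absorbs the
  linear term, and what remains is constant in \<open>x\<close>.\<close>

lemma complete_square_diff:
  fixes x y m :: "'a::real_inner"
  assumes "0 < s" "s < V"
  shows "(norm (x - y))\<^sup>2 / s - (norm (x - m))\<^sup>2 / V =
    (norm (x - ((V / (V - s)) *\<^sub>R y - (s / (V - s)) *\<^sub>R m)))\<^sup>2 / (s * V / (V - s))
      - (norm (y - m))\<^sup>2 / (V - s)"
proof -
  define a where "a = V / (V - s)"
  define b where "b = s / (V - s)"
  define k where "k = 1 / (s * V / (V - s))"
  have sq: "(norm (u - w))\<^sup>2 = u \<bullet> u - 2 * (u \<bullet> w) + w \<bullet> w" for u w :: 'a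
    by (simp add: power2_norm_eq_inner inner_diff_left inner_diff_right inner_commute)
  define d where "d = V - s"
  have nz: "s \<noteq> 0" "d \<noteq> 0" "V \<noteq> 0" and V: "V = s + d"
    using assms by (auto simp: d_def)
  have "k = d / (s * V)" "a = V / d" "b = s / d"
    using nz by (simp_all add: a_def b_def k_def d_def)
  \<comment> \<open>These six products are the coefficients of the expanded square. Partial
    fractions then turn them into combinations of \<open>1 / s\<close>, \<open>1 / V\<close> and
    \<open>1 / d\<close>.\<close>
  then have "k = d / (s * V)" "a * k = 1 / s" "b * k = 1 / V" "a * a * k = V / (s * d)"
      "b * b * k = s / (d * V)" "a * b * k = 1 / d"
    using nz by simp_all
  moreover have "d / (s * V) = 1 / s - 1 / V" "V / (s * d) = 1 / s + 1 / d"
      "s / (d * V) = 1 / d - 1 / V"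
    using nz unfolding V by (simp_all add: divide_simps)
  ultimately have k: "k = 1 / s - 1 / V" "a * k = 1 / s" "b * k = 1 / V" "a * a * k = 1 / s + 1 / d"
      "b * b * k = 1 / d - 1 / V" "a * b * k = 1 / d"
    by simp_all
  have "(norm (x - (a *\<^sub>R y - b *\<^sub>R m)))\<^sup>2 * k = k * (x \<bullet> x) + (a * a * k) * (y \<bullet> y)
      + (b * b * k) * (m \<bullet> m) - 2 * (a * k) * (x \<bullet> y) + 2 * (b * k) * (x \<bullet> m)
      - 2 * (a * b * k) * (y \<bullet> m)"
    unfolding sq[of x] sq[of "a *\<^sub>R y"] inner_diff_right
    by (simp add: inner_diff_left inner_diff_right inner_commute algebra_simps)
  also have "\<dots> = (norm (x - y))\<^sup>2 / s - (norm (x - m))\<^sup>2 / V + (norm (y - m))\<^sup>2 / d"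
    \<comment> \<open>The products go first: rewriting \<open>k\<close> itself would destroy their
      patterns.\<close>
    unfolding k(2-)
    unfolding k(1) sq by (simp add: algebra_simps add_divide_distrib diff_divide_distrib)
  finally show ?thesis
    by (simp add: a_def b_def k_def d_def)
qed

lemma iso_gauss_factor:
  fixes y m :: "real ^ 'n"
  assumes "0 < s" "s < V"
  obtains C where "C > 0" and
    "\<And>x. iso_gauss x y s = C * iso_gauss x m V *
      iso_gauss x ((V / (V - s)) *\<^sub>R y - (s / (V - s)) *\<^sub>R m) (s * V / (V - s))"
proof -
  define xh where "xh = (V / (V - s)) *\<^sub>R y - (s / (V - s)) *\<^sub>R m"
  define vh where "vh = s * V / (V - s)"
  define N where "N w = (2 * pi * w) powr (- real CARD('n) / 2)" for w
  define E where "E = exp ((norm (y - m))\<^sup>2 / (2 * (V - s)))"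
  have N: "N s > 0" "N V > 0" "N vh > 0" and E: "E > 0"
    using assms by (auto simp: N_def vh_def E_def)
  have "iso_gauss x y s = N s * E / (N V * N vh) * iso_gauss x m V * iso_gauss x xh vh" for x
  proof -
    have half: "u / (2 * w) = u / w / 2" for u w :: real
      by simp
    \<comment> \<open>Here \<open>p\<close>, \<open>q\<close>, \<open>t\<close> are the quadratic
      terms centred at \<open>y\<close>, \<open>m\<close>, \<open>xh\<close>, and \<open>r\<close>
      is the constant remainder, each before halving.\<close>
    have *: "- (p / 2) = r / 2 + - (q / 2) + - (t / 2)" if "p - q = t - r" for p q r t :: real
      using that by linarith
    have "- (norm (x - y))\<^sup>2 / (2 * s) = (norm (y - m))\<^sup>2 / (2 * (V - s))
        + - (norm (x - m))\<^sup>2 / (2 * V) + - (norm (x - xh))\<^sup>2 / (2 * vh)"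
      using complete_square_diff[OF assms, of x y m, folded xh_def vh_def]
      unfolding half minus_divide_left[symmetric] by (rule *)
    then have "exp (- (norm (x - y))\<^sup>2 / (2 * s)) =
        E * exp (- (norm (x - m))\<^sup>2 / (2 * V)) * exp (- (norm (x - xh))\<^sup>2 / (2 * vh))"
      by (simp only: exp_add E_def)
    then show ?thesis
      unfolding iso_gauss_def N_def[symmetric] using N by simp
  qed
  then show thesis
    \<comment> \<open>The constant collects the three normalising factors and the exponential of the
      remainder, all independent of \<open>x\<close>.\<close>
    using N E by (intro that[of "N s * E / (N V * N vh)"]) (simp_all add: xh_def vh_def)
qed

text \<open>\<open>H\<close> stands for the value of \<open>h\<close> at the starting point. It
  depends on \<open>q\<close> but not on \<open>x\<close>, so normalisation of \<open>q\<close>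
  determines the product \<open>H * C\<close>.\<close>

lemma prob_density_weight_iso_gauss:
  fixes y m :: "real ^ 'n"
  assumes "0 < s" "s < V" and q: "prob_density q"
    and ae: "AE x in lborel. iso_gauss x m V * q x / H = iso_gauss x y s"
  shows "AE x in lborel. q x =
    iso_gauss x ((V / (V - s)) *\<^sub>R y - (s / (V - s)) *\<^sub>R m) (s * V / (V - s))"
proof -
  define G where
    "G x = iso_gauss x ((V / (V - s)) *\<^sub>R y - (s / (V - s)) *\<^sub>R m) (s * V / (V - s))" for x
  obtain C where "C > 0" and C: "\<And>x. iso_gauss x y s = C * iso_gauss x m V * G x"
    unfolding G_def using iso_gauss_factor[OF assms(1,2)] by blast
  have "H \<noteq> 0"
  proof
    \<comment> \<open>Division by zero yields 0, so a strictly positive Gaussian would vanish almost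
      everywhere, although Lebesgue measure is not null.\<close>
    assume "H = 0"
    with ae have "AE x in (lborel :: (real ^ 'n) measure). False"
      using iso_gauss_pos[OF \<open>0 < s\<close>, of _ y] by (auto simp: less_le)
    then show False
      by (simp add: eventually_False ae_filter_eq_bot_iff)
  qed
  have qG: "AE x in lborel. q x = H * C * G x"
    using ae
  proof eventually_elim
    case (elim x)
    have "iso_gauss x m V > 0"
      using assms(1,2) by (intro iso_gauss_pos) simp
    with elim C[of x] \<open>H \<noteq> 0\<close> show ?case
      by (simp add: field_simps)
  qed
  have G: "has_bochner_integral lborel G 1"
    unfolding G_def using assms(1,2) by (intro has_bochner_integral_iso_gauss) simp
  have qI: "has_bochner_integral lborel q 1"
    using q by (simp add: prob_density_def)
  have "1 = (\<integral>x. q x \<partial>lborel)"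
    using qI by (simp add: has_bochner_integral_iff)
  also have "\<dots> = (\<integral>x. H * C * G x \<partial>lborel)"
    using G qI qG by (intro integral_cong_AE) (auto simp: has_bochner_integral_iff)
  also have "\<dots> = H * C"
    using G by (simp add: has_bochner_integral_iff)
  finally show ?thesis
    using qG by (simp add: G_def)
qed

theorem theorem3p2:
  fixes T \<sigma> :: real
    and \<theta> g :: "real \<Rightarrow> real"
    and \<mu> x0 x_star :: "real ^ 'n"
    and q :: "real ^ 'n \<Rightarrow> real"
  assumes "0 < T"
    and "\<And>t. t \<in> {0..T} \<Longrightarrow> 0 < \<theta> t"
    and "\<theta> integrable_on {0..T}"
    and "(\<lambda>t. (g t)\<^sup>2) integrable_on {0..T}"
    and "prob_density q"
    and "0 < \<sigma>\<^sup>2"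
    and "\<sigma>\<^sup>2 < gou_var \<theta> g 0 T"
    and "AE x in lborel. gou_h_terminal_density \<theta> g \<mu> T q x0 x = iso_gauss x x_star (\<sigma>\<^sup>2)"
  shows "(AE x in lborel. q x =
            iso_gauss x
              ((gou_var \<theta> g 0 T / (gou_var \<theta> g 0 T - \<sigma>\<^sup>2)) *\<^sub>R x_star
                - (\<sigma>\<^sup>2 / (gou_var \<theta> g 0 T - \<sigma>\<^sup>2)) *\<^sub>R gou_mean \<theta> \<mu> 0 T x0)
              (\<sigma>\<^sup>2 * gou_var \<theta> g 0 T / (gou_var \<theta> g 0 T - \<sigma>\<^sup>2)))
       \<and> (\<forall>q'. prob_density q'
              \<and> (AE x in lborel.
                   gou_h_terminal_density \<theta> g \<mu> T q' x0 x = iso_gauss x x_star (\<sigma>\<^sup>2))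
            \<longrightarrow> (AE x in lborel. q' x = q x))"
proof -
  \<comment> \<open>Stated for an arbitrary weight \<open>p\<close>, this gives both the formula for
    \<open>q\<close> and uniqueness: the right side does not mention \<open>p\<close>.\<close>
  have main: "AE x in lborel. p x =
      iso_gauss x
        ((gou_var \<theta> g 0 T / (gou_var \<theta> g 0 T - \<sigma>\<^sup>2)) *\<^sub>R x_star
          - (\<sigma>\<^sup>2 / (gou_var \<theta> g 0 T - \<sigma>\<^sup>2)) *\<^sub>R gou_mean \<theta> \<mu> 0 T x0)
        (\<sigma>\<^sup>2 * gou_var \<theta> g 0 T / (gou_var \<theta> g 0 T - \<sigma>\<^sup>2))"
    if "prob_density p"
      and "AE x in lborel. gou_h_terminal_density \<theta> g \<mu> T p x0 x = iso_gauss x x_star (\<sigma>\<^sup>2)"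
    for p
    \<comment> \<open>\<open>gou_h\<close> stays folded, so that its value at \<open>x0\<close> and
      time 0 is matched with \<open>H\<close>.\<close>
    using that(2) unfolding gou_h_terminal_density_def gou_density_def
    by (rule prob_density_weight_iso_gauss[OF assms(6,7) that(1)])
  show ?thesis
  proof (intro conjI allI impI)
    fix q' :: "real ^ 'n \<Rightarrow> real"
    assume "prob_density q' \<and>
      (AE x in lborel. gou_h_terminal_density \<theta> g \<mu> T q' x0 x = iso_gauss x x_star (\<sigma>\<^sup>2))"
    then show "AE x in lborel. q' x = q x"
      using main[of q'] main[OF assms(5,8)] by auto
  qed (rule main[OF assms(5,8)])
qed

end
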